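(* Let $X=[0,b]$ with $b>0$, and for each $t\in\mathbb{N}^0=\{0,1,2,\dots\}$ let $\Omega_t\subset X\times X$ and $u_t:X\times X\to\mathbb{R}$ be such that assumptions M1, M2 and M3 of the context hold. Let $x\in X$ and let $\langle x_t\mid t\in\mathbb{N}^0\rangle\in\mathcal{F}(x)$. Then $\langle x_t\mid t\in\mathbb{N}^0\rangle\in\mathcal{S}(x)$ if and only if for all $\langle y_t\mid t\in\mathbb{N}^0\rangle\in\mathcal{F}(x)$ it is the case that $$D_1u_0(x_0,x_1)(x_0-y_0)+\sum_{t=1}^{\infty}\bigl[D_2u_{t-1}(x_{t-1},x_t)+D_1u_t(x_t,x_{t+1})\bigr](x_t-y_t)=\sum_{t=1}^{\infty}\bigl[D_2u_{t-1}(x_{t-1},x_t)+D_1u_t(x_t,x_{t+1})\bigr](x_t-y_t)\ \ge\ 0 .$$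
   Context: Assumptions. M1: (i) for all $t\in\mathbb{N}^0$, $\Omega_t$ is a non-empty, closed and convex subset of $X\times X$; (ii) for all $t\in\mathbb{N}^0$ and $x\in X$ there exists $y\in X$ (possibly depending on $x$) with $(x,y)\in\Omega_t$. M2: for all $t\in\mathbb{N}^0$, $u_t$ is bounded, concave and continuously differentiable on $X\times X$, where $D_1u_t(x,y)=\lim_{h\to0,\,x+h\in X}\frac{u_t(x+h,y)-u_t(x,y)}{h}$ and $D_2u_t(x,y)=\lim_{h\to0,\,y+h\in X}\frac{u_t(x,y+h)-u_t(x,y)}{h}$ (so $D_1u_t$ is a one-sided partial derivative when $x\in\{0,b\}$, and $D_2u_t$ is one when $y\in\{0,b\}$). M3: for all sequences $\langle x_t\mid t\in\mathbb{N}^0\rangle$, $\langle y_t\mid t\in\mathbb{N}^0\rangle$ with $(x_t,y_t)\in X\times X$ for all $t\in\mathbb{N}^0$, $\sum_{t=0}^\infty|D_iu_t(x_t,y_t)|<+\infty$ for $i\in\{1,2\}$. Notation. For $x\in X$, $\mathcal{F}(x)$ is the set of sequences $\langle x_t\mid t\in\mathbb{N}^0\rangle$ with $x_0=x$ and $(x_t,x_{t+1})\in\Omega_t$ for all $t\in\mathbb{N}^0$. $\mathcal{S}(x)$ is the set of $\langle x_t\mid t\in\mathbb{N}^0\rangle\in\mathcal{F}(x)$ such that $\sum_{t=0}^\infty u_t(x_t,x_{t+1})\ge\sum_{t=0}^\infty u_t(y_t,y_{t+1})$ for all $\langle y_t\mid t\in\mathbb{N}^0\rangle\in\mathcal{F}(x)$.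 The expression $\sum_{t=0}^\infty u_t(x_t,x_{t+1})$ means $\lim_{T\to\infty}\sum_{t=0}^Tu_t(x_t,x_{t+1})$.
   Formalization: The formal theorem additionally assumes that the series of u_t(x_t,x_{t+1}) converges to a finite limit for the given path; M1–M3 do not imply this (e.g. u_t=(-1)^t), and without it optimality is undefined or the equivalence fails. *)

theory Defs
  imports "HOL-Analysis.Analysis"
begin

text \<open>The state space is \<open>X = {0..b}\<close>.  Functions on \<open>X \<times> X\<close> are total functions on pairs of
  reals; only their values on \<open>X \<times> X\<close> matter below.\<close>

text \<open>Increments are restricted to those staying in \<open>X\<close>, so the derivatives are one-sided on the
  boundary.\<close>

definition D1 :: "real \<Rightarrow> (real \<times> real \<Rightarrow> real) \<Rightarrow> real \<times> real \<Rightarrow> real" where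
  "D1 b v = (\<lambda>(x, y). Lim (at 0 within {h. x + h \<in> {0..b}}) (\<lambda>h. (v (x + h, y) - v (x, y)) / h))"

definition D2 :: "real \<Rightarrow> (real \<times> real \<Rightarrow> real) \<Rightarrow> real \<times> real \<Rightarrow> real" where
  "D2 b v = (\<lambda>(x, y). Lim (at 0 within {h. y + h \<in> {0..b}}) (\<lambda>h. (v (x, y + h) - v (x, y)) / h))"

definition continuously_differentiable :: "real \<Rightarrow> (real \<times> real \<Rightarrow> real) \<Rightarrow> bool" where
  "continuously_differentiable b v \<longleftrightarrow>
     (\<forall>x\<in>{0..b}. \<forall>y\<in>{0..b}.
        (\<lambda>s. v (s, y)) differentiable (at x within {0..b}) \<and>
        (\<lambda>s. v (x, s)) differentiable (at y within {0..b})) \<and>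
     continuous_on ({0..b} \<times> {0..b}) (D1 b v) \<and>
     continuous_on ({0..b} \<times> {0..b}) (D2 b v)"

definition M1 :: "real \<Rightarrow> (nat \<Rightarrow> (real \<times> real) set) \<Rightarrow> bool" where
  "M1 b \<Omega> \<longleftrightarrow>
     (\<forall>t. \<Omega> t \<noteq> {} \<and> \<Omega> t \<subseteq> {0..b} \<times> {0..b} \<and> closed (\<Omega> t) \<and> convex (\<Omega> t)) \<and>
     (\<forall>t. \<forall>x\<in>{0..b}. \<exists>y\<in>{0..b}. (x, y) \<in> \<Omega> t)"

definition M2 :: "real \<Rightarrow> (nat \<Rightarrow> real \<times> real \<Rightarrow> real) \<Rightarrow> bool" where
  "M2 b u \<longleftrightarrow>
     (\<forall>t. bounded (u t ` ({0..b} \<times> {0..b})) \<and>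
          concave_on ({0..b} \<times> {0..b}) (u t) \<and>
          continuously_differentiable b (u t))"

definition M3 :: "real \<Rightarrow> (nat \<Rightarrow> real \<times> real \<Rightarrow> real) \<Rightarrow> bool" where
  "M3 b u \<longleftrightarrow>
     (\<forall>x y :: nat \<Rightarrow> real. (\<forall>t. (x t, y t) \<in> {0..b} \<times> {0..b}) \<longrightarrow>
        summable (\<lambda>t. \<bar>D1 b (u t) (x t, y t)\<bar>) \<and>
        summable (\<lambda>t. \<bar>D2 b (u t) (x t, y t)\<bar>))"

definition feasible :: "(nat \<Rightarrow> (real \<times> real) set) \<Rightarrow> real \<Rightarrow> (nat \<Rightarrow> real) set" where
  "feasible \<Omega> x0 = {x. x 0 = x0 \<and> (\<forall>t. (x t, x (Suc t)) \<in> \<Omega> t)}"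

text \<open>\<^const>\<open>suminf\<close> is an unspecified value on divergent series.  Comparing two sums includes that
  both limits of partial sums exist.\<close>

definition optimal ::
  "(nat \<Rightarrow> (real \<times> real) set) \<Rightarrow> (nat \<Rightarrow> real \<times> real \<Rightarrow> real) \<Rightarrow> real \<Rightarrow> (nat \<Rightarrow> real) set" where
  "optimal \<Omega> u x0 =
     {x \<in> feasible \<Omega> x0. \<forall>y \<in> feasible \<Omega> x0.
        summable (\<lambda>t. u t (x t, x (Suc t))) \<and>
        summable (\<lambda>t. u t (y t, y (Suc t))) \<and>
        (\<Sum>t. u t (x t, x (Suc t))) \<ge> (\<Sum>t. u t (y t, y (Suc t)))}"

text \<open>Meant for \<open>t \<ge> 1\<close>: at \<open>t = 0\<close> the subtraction truncates.\<close>

definition euler_term ::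
  "real \<Rightarrow> (nat \<Rightarrow> real \<times> real \<Rightarrow> real) \<Rightarrow> (nat \<Rightarrow> real) \<Rightarrow> (nat \<Rightarrow> real) \<Rightarrow> nat \<Rightarrow> real" where
  "euler_term b u x y t =
     (D2 b (u (t - 1)) (x (t - 1), x t) + D1 b (u t) (x t, x (t + 1))) * (x t - y t)"

end

theory Submission
  imports Defs
begin

text \<open>A concave function lies below its tangent plane, and on a square continuous partial derivatives
  give total differentiability, so the tangent plane is given by \<^const>\<open>D1\<close> and \<^const>\<open>D2\<close>, also on
  the boundary.  Choosing maximisers of \<open>\<bar>D1\<bar>\<close> and \<open>\<bar>D2\<bar>\<close> in each period, M3 yields a summable bound
  on both that is uniform over the square; so Euler series and utility differences sum absolutely.  Sufficiency follows by
  summing the tangent inequality at \<open>x\<close>.  For necessity, apply the tangent inequality at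
  \<open>x + a (y - x)\<close> instead, divide the summed inequality by \<open>a\<close> and let \<open>a\<close> tend to \<open>0\<close> by
  Tannery's theorem.\<close>

section \<open>Concavity, partial derivatives and the tangent plane\<close>

text \<open>Along the segment from \<open>p\<close> to \<open>q\<close>, concavity makes every
  difference quotient at \<open>s\<close> in (0,1] at least \<open>f q - f p\<close>, and the
  quotients tend to \<open>L (q - p)\<close> as \<open>s\<close> falls to 0. A derivative within
  \<open>S\<close> suffices, so \<open>p\<close> may be a boundary point.\<close>

lemma concave_on_le_tangent:
  fixes f :: "'a::real_normed_vector \<Rightarrow> real"
  assumes conc: "concave_on S f" and p: "p \<in> S" and q: "q \<in> S"
    and deriv: "(f has_derivative L) (at p within S)"
  shows "f q - f p \<le> L (q - p)"
proof -
  define \<gamma> where "\<gamma> s = p + s *\<^sub>R (q - p)" for s :: real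
  have \<gamma>_eq: "\<gamma> s = (1 - s) *\<^sub>R p + s *\<^sub>R q" for s
    by (simp add: \<gamma>_def algebra_simps)
  have conv: "convex S"
    using conc by (simp add: concave_on_def convex_on_def)
  have \<gamma>_in: "\<gamma> ` {0..1} \<subseteq> S"
    using conv p q by (auto simp: \<gamma>_eq convex_alt)
  have "(\<gamma> has_derivative (\<lambda>s. s *\<^sub>R (q - p))) (at 0 within {0..1})"
    unfolding \<gamma>_def by (auto intro!: derivative_eq_intros)
  moreover have "(f has_derivative L) (at (\<gamma> 0) within \<gamma> ` {0..1})"
    using has_derivative_subset[OF deriv \<gamma>_in] by (simp add: \<gamma>_def)
  ultimately have "((\<lambda>s. f (\<gamma> s)) has_derivative (\<lambda>s. L (s *\<^sub>R (q - p)))) (at 0 within {0..1})"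
    by (rule has_derivative_in_compose)
  moreover have "(\<lambda>s. L (s *\<^sub>R (q - p))) = (*) (L (q - p))"
    using has_derivative_bounded_linear[OF deriv]
    by (simp add: fun_eq_iff bounded_linear.linear linear_cmul)
  ultimately have "((\<lambda>s. f (\<gamma> s)) has_field_derivative L (q - p)) (at 0 within {0..1})"
    by (simp add: has_field_derivative_def)
  then have lim: "((\<lambda>s. (f (\<gamma> s) - f p) / s) \<longlongrightarrow> L (q - p)) (at 0 within {0..1})"
    by (simp add: has_field_derivative_iff \<gamma>_def)
  have "f q - f p \<le> (f (\<gamma> s) - f p) / s" if "0 < s" "s \<le> 1" for s
  proof -
    have "f (\<gamma> s) \<ge> (1 - s) * f p + s * f q"
      using conc that p q by (simp add: \<gamma>_eq concave_on_iff)
    with that show ?thesis by (simp add: field_simps)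
  qed
  then have "\<forall>\<^sub>F s in at 0 within {0..1}. f q - f p \<le> (f (\<gamma> s) - f p) / s"
    by (auto simp: eventually_at_filter)
  with lim show ?thesis
    by (rule tendsto_lowerbound) (simp add: trivial_limit_within)
qed

text \<open>\<open>Lim\<close> carries information only if the limit exists and is unique.
  Differentiability gives existence; \<open>b > 0\<close> makes 0 a limit point of the admissible
  increments, which gives uniqueness.\<close>

lemma Lim_difference_quotient:
  fixes f :: "real \<Rightarrow> real"
  assumes "b > 0" "x \<in> {0..b}" "f differentiable (at x within {0..b})"
  shows "(f has_field_derivative
    Lim (at 0 within {h. x + h \<in> {0..b}}) (\<lambda>h. (f (x + h) - f x) / h)) (at x within {0..b})"
proof -
  let ?S = "{h. x + h \<in> {0..b}}"
  obtain D where D: "(f has_field_derivative D) (at x within {0..b})"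
    using assms(3) by (auto simp: real_differentiable_def)
  have S: "(+) x ` ?S = {0..b}"
    by (auto intro!: image_eqI[where x = "_ - x"])
  have "((\<lambda>h. f (x + h)) has_field_derivative D) (at 0 within ?S)"
    using D DERIV_at_within_shift[of f D x 0 ?S] by (simp only: S) simp
  then have lim: "((\<lambda>h. (f (x + h) - f x) / h) \<longlongrightarrow> D) (at 0 within ?S)"
    by (simp add: has_field_derivative_iff)
  have "?S = {-x..b - x}" by auto
  then have "at 0 within ?S \<noteq> bot"
    using assms(1,2) by (simp add: trivial_limit_within)
  then have "Lim (at 0 within ?S) (\<lambda>h. (f (x + h) - f x) / h) = D"
    using lim by (rule tendsto_Lim)
  with D show ?thesis by simp
qed

text \<open>The second partial exists on the whole square and is jointly continuous, which combines
  the partials at \<open>p\<close> into a total derivative, on the edges as well.\<close>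

lemma has_derivative_D1_D2:
  assumes b: "b > 0" and cd: "continuously_differentiable b v" and p: "p \<in> {0..b} \<times> {0..b}"
  shows "(v has_derivative (\<lambda>d. D1 b v p * fst d + D2 b v p * snd d))
    (at p within {0..b} \<times> {0..b})"
proof -
  obtain x y where xy: "p = (x, y)" "x \<in> {0..b}" "y \<in> {0..b}" using p by auto
  have 1: "((\<lambda>s. v (s, y)) has_derivative (*) (D1 b v (x, y))) (at x within {0..b})"
    using Lim_difference_quotient[OF b, of x "\<lambda>s. v (s, y)"] cd xy
    by (simp add: D1_def continuously_differentiable_def has_field_derivative_def)
  \<comment> \<open>\<open>blinfun_mult_right\<close> turns the number
    \<open>D2 b v (x', y')\<close> into a bounded linear map, so that its continuity can be stated
    in operator norm.\<close>
  have 2: "((\<lambda>s. v (x', s)) has_derivative blinfun_mult_right (D2 b v (x', y'))) (at y' within {0..b})"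
    if "x' \<in> {0..b}" "y' \<in> {0..b}" for x' y'
    using Lim_difference_quotient[OF b, of y' "\<lambda>s. v (x', s)"] cd that
    by (simp add: D2_def continuously_differentiable_def has_field_derivative_def)
  have 3: "continuous (at (x, y) within {0..b} \<times> {0..b})
      (\<lambda>(x, y). blinfun_mult_right (D2 b v (x, y)))"
  proof -
    have "continuous (at (x, y) within {0..b} \<times> {0..b}) (D2 b v)"
      using cd xy by (simp add: continuously_differentiable_def continuous_on_eq_continuous_within)
    then show ?thesis
      by (simp add: case_prod_unfold bounded_linear.continuous[OF bounded_linear_blinfun_mult_right])
  qed
  show ?thesis
    using has_derivative_partialsI[where f = "\<lambda>x y. v (x, y)", OF 1 2 3] xy
    by (simp add: case_prod_unfold)
qed

lemma concave_gradient_inequality: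
  assumes "b > 0" "continuously_differentiable b v" "concave_on ({0..b} \<times> {0..b}) v"
    and "p \<in> {0..b} \<times> {0..b}" "q \<in> {0..b} \<times> {0..b}"
  shows "v q - v p \<le> D1 b v p * (fst q - fst p) + D2 b v p * (snd q - snd p)"
  using concave_on_le_tangent[OF assms(3-5) has_derivative_D1_D2[OF assms(1,2,4)]]
  by (simp only: fst_diff snd_diff)

section \<open>Summable bounds uniform over the square\<close>

lemma summable_uniform_bound:
  fixes f :: "nat \<Rightarrow> 'a::topological_space \<Rightarrow> real"
  assumes "compact S" "S \<noteq> {}" "\<And>t. continuous_on S (f t)"
    and summable: "\<And>z. (\<And>t. z t \<in> S) \<Longrightarrow> summable (\<lambda>t. \<bar>f t (z t)\<bar>)"
  obtains M where "summable M" "\<And>t p. p \<in> S \<Longrightarrow> \<bar>f t p\<bar> \<le> M t"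
proof -
  have "\<exists>p\<in>S. \<forall>q\<in>S. \<bar>f t q\<bar> \<le> \<bar>f t p\<bar>" for t
    using assms(1-3) by (intro continuous_attains_sup continuous_on_rabs) auto
  then obtain z where "\<And>t. z t \<in> S" "\<And>t q. q \<in> S \<Longrightarrow> \<bar>f t q\<bar> \<le> \<bar>f t (z t)\<bar>"
    by metis
  with summable[of z] that[of "\<lambda>t. \<bar>f t (z t)\<bar>"] show thesis by blast
qed

lemma M3_uniform_bound:
  assumes b: "b > 0" and "M2 b u" and "M3 b u"
  obtains M where "summable M"
    and "\<And>t p. p \<in> {0..b} \<times> {0..b} \<Longrightarrow> \<bar>D1 b (u t) p\<bar> \<le> M t"
    and "\<And>t p. p \<in> {0..b} \<times> {0..b} \<Longrightarrow> \<bar>D2 b (u t) p\<bar> \<le> M t"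
proof -
  let ?S = "{0..b} \<times> {0..b}"
  have S: "compact ?S" "?S \<noteq> {}"
    using b by (auto intro: compact_Times)
  have sum: "summable (\<lambda>t. \<bar>D1 b (u t) (z t)\<bar>)" "summable (\<lambda>t. \<bar>D2 b (u t) (z t)\<bar>)"
    if "\<And>t. z t \<in> ?S" for z
    using assms(3)[unfolded M3_def, rule_format, of "fst \<circ> z" "snd \<circ> z"] that by simp_all
  obtain M where M: "summable M" "\<And>t p. p \<in> ?S \<Longrightarrow> \<bar>D1 b (u t) p\<bar> \<le> M t"
    using summable_uniform_bound[OF S, of "\<lambda>t. D1 b (u t)"] sum(1) assms(2)
    unfolding M2_def continuously_differentiable_def by blast
  obtain N where N: "summable N" "\<And>t p. p \<in> ?S \<Longrightarrow> \<bar>D2 b (u t) p\<bar> \<le> N t"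
    using summable_uniform_bound[OF S, of "\<lambda>t. D2 b (u t)"] sum(2) assms(2)
    unfolding M2_def continuously_differentiable_def by blast
  \<comment> \<open>Nonnegativity, read off at the corner (0,0), lets \<open>M t + N t\<close>
    dominate both partials at once.\<close>
  have "M t \<ge> 0" "N t \<ge> 0" for t
    using M(2)[of "(0,0)" t] N(2)[of "(0,0)" t] b by auto
  then have "\<bar>D1 b (u t) p\<bar> \<le> M t + N t" "\<bar>D2 b (u t) p\<bar> \<le> M t + N t" if "p \<in> ?S" for t p
    using M(2)[OF that, of t] N(2)[OF that, of t] by (simp_all add: add_increasing add_increasing2)
  then show thesis
    using that[of "\<lambda>t. M t + N t"] summable_add[OF M(1) N(1)] by blast
qed

section \<open>Feasible paths and first-order terms along them\<close>

lemma feasible_square: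
  assumes "M1 b \<Omega>" "y \<in> feasible \<Omega> x0"
  shows "(y t, y (Suc t)) \<in> {0..b} \<times> {0..b}"
  using assms unfolding M1_def feasible_def by blast

text \<open>The path is \<open>(1 - a) x + a y\<close>, so convexity of each
  \<open>\<Omega> t\<close> applies period by period, and the common initial state is kept.\<close>

lemma feasible_convex_combination:
  assumes "M1 b \<Omega>" "x \<in> feasible \<Omega> x0" "y \<in> feasible \<Omega> x0" "0 \<le> a" "a \<le> 1"
  shows "(\<lambda>t. x t + a * (y t - x t)) \<in> feasible \<Omega> x0"
proof -
  have "(x t + a * (y t - x t), x (Suc t) + a * (y (Suc t) - x (Suc t))) \<in> \<Omega> t" for t
  proof -
    have "(1 - a) *\<^sub>R (x t, x (Suc t)) + a *\<^sub>R (y t, y (Suc t)) \<in> \<Omega> t"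
      using assms by (intro convexD) (auto simp: M1_def feasible_def)
    then show ?thesis by (simp add: algebra_simps)
  qed
  then show ?thesis using assms(2,3) by (simp add: feasible_def)
qed

text \<open>The derivative of \<open>u t\<close> at \<open>(x t, x (Suc t))\<close> in the direction
  \<open>(d t, d (Suc t))\<close>. The direction \<open>d\<close> is a separate argument so that the
  base path can move while \<open>d\<close> stays fixed.\<close>

definition gradient_term ::
  "real \<Rightarrow> (nat \<Rightarrow> real \<times> real \<Rightarrow> real) \<Rightarrow> (nat \<Rightarrow> real) \<Rightarrow> (nat \<Rightarrow> real) \<Rightarrow> nat \<Rightarrow> real" where
  "gradient_term b u x d t = D1 b (u t) (x t, x (Suc t)) * d t + D2 b (u t) (x t, x (Suc t)) * d (Suc t)"

lemma gradient_term_mult: "gradient_term b u x (\<lambda>t. a * d t) t = a * gradient_term b u x d t"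
  by (simp add: gradient_term_def algebra_simps)

lemma utility_diff_le_gradient_term:
  assumes "b > 0" "M1 b \<Omega>" "M2 b u" "x \<in> feasible \<Omega> x0" "y \<in> feasible \<Omega> x0"
  shows "u t (y t, y (Suc t)) - u t (x t, x (Suc t)) \<le> gradient_term b u x (\<lambda>t. y t - x t) t"
proof -
  have "continuously_differentiable b (u t)" "concave_on ({0..b} \<times> {0..b}) (u t)"
    using assms(3) unfolding M2_def by blast+
  from concave_gradient_inequality[OF assms(1) this
      feasible_square[OF assms(2,4)] feasible_square[OF assms(2,5)]]
  show ?thesis
    unfolding gradient_term_def by (simp only: fst_conv snd_conv)
qed

lemma abs_gradient_term_le:
  assumes "\<bar>D1 b (u t) (x t, x (Suc t))\<bar> \<le> m" "\<bar>D2 b (u t) (x t, x (Suc t))\<bar> \<le> m"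
    and "\<bar>d t\<bar> \<le> c" "\<bar>d (Suc t)\<bar> \<le> c"
  shows "\<bar>gradient_term b u x d t\<bar> \<le> 2 * m * c"
proof -
  have "\<bar>D1 b (u t) (x t, x (Suc t)) * d t\<bar> \<le> m * c" "\<bar>D2 b (u t) (x t, x (Suc t)) * d (Suc t)\<bar> \<le> m * c"
    unfolding abs_mult using assms by (auto intro!: mult_mono)
  then show ?thesis unfolding gradient_term_def by linarith
qed

text \<open>Summation by parts: the boundary term vanishes because both paths start at \<open>x0\<close>.\<close>

lemma euler_term_sums:
  assumes b: "b > 0" and "M1 b \<Omega>" "M2 b u" "M3 b u"
    and x: "x \<in> feasible \<Omega> x0" and y: "y \<in> feasible \<Omega> x0"
  shows "(\<lambda>t. euler_term b u x y (Suc t)) sums (\<Sum>t. gradient_term b u x (\<lambda>t. x t - y t) t)"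
proof -
  obtain M where M: "summable M"
    "\<And>t p. p \<in> {0..b} \<times> {0..b} \<Longrightarrow> \<bar>D1 b (u t) p\<bar> \<le> M t"
    "\<And>t p. p \<in> {0..b} \<times> {0..b} \<Longrightarrow> \<bar>D2 b (u t) p\<bar> \<le> M t"
    using M3_uniform_bound[OF assms(1,3,4)] by blast
  define A where "A t = D1 b (u t) (x t, x (Suc t)) * (x t - y t)" for t
  define C where "C t = D2 b (u t) (x t, x (Suc t)) * (x (Suc t) - y (Suc t))" for t
  note xs = feasible_square[OF assms(2) x] and ys = feasible_square[OF assms(2) y]
  have d: "\<bar>x t - y t\<bar> \<le> b" for t
    using xs[of t] ys[of t] by auto
  have "0 \<le> M t" for t
    using M(2)[OF xs, of t] abs_ge_zero order_trans by blast
  then have "norm (A t) \<le> M t * b" "norm (C t) \<le> M t * b" for t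
    unfolding A_def C_def real_norm_def abs_mult
    by (intro mult_mono M xs d abs_ge_zero; assumption)+
  \<comment> \<open>Separate summability matters: the index shift below acts on \<open>A\<close>
    alone.\<close>
  then have sum: "summable A" "summable C"
    using summable_comparison_test'[OF summable_mult2[OF M(1), of b]] by blast+
  have "A 0 = 0" using x y by (simp add: A_def feasible_def)
  then have "(\<lambda>t. A (Suc t)) sums suminf A"
    using summable_sums[OF sum(1)] by (simp add: sums_Suc_iff)
  \<comment> \<open>Regrouping by state: \<open>C t\<close> and \<open>A (Suc t)\<close> both
    multiply \<open>x (Suc t) - y (Suc t)\<close>, and together they form the Euler term at
    \<open>Suc t\<close>.\<close>
  from sums_add[OF summable_sums[OF sum(2)] this]
  have "(\<lambda>t. C t + A (Suc t)) sums (suminf A + suminf C)" by (simp add: add.commute)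
  moreover have "(\<lambda>t. C t + A (Suc t)) = (\<lambda>t. euler_term b u x y (Suc t))"
    by (simp add: A_def C_def euler_term_def fun_eq_iff algebra_simps)
  moreover have "gradient_term b u x (\<lambda>t. x t - y t) = (\<lambda>t. A t + C t)"
    by (simp add: A_def C_def gradient_term_def fun_eq_iff)
  ultimately show ?thesis using sum by (simp add: suminf_add)
qed

section \<open>The characterization of optimal paths\<close>

text \<open>The derivative bounds control only differences of utilities. If every \<open>u t\<close>
  is constantly 1, the Euler series vanish but no utility series converges, so
  \<open>optimal\<close> is empty; hence the hypothesis \<open>objective_converges\<close>.\<close>

theorem proposition2p1:
  fixes b x0 :: real
    and \<Omega> :: "nat \<Rightarrow> (real \<times> real) set"
    and u :: "nat \<Rightarrow> real \<times> real \<Rightarrow> real"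
    and x :: "nat \<Rightarrow> real"
  assumes "b > 0"
    and "M1 b \<Omega>" and "M2 b u" and "M3 b u"
    and "x0 \<in> {0..b}"
    and "x \<in> feasible \<Omega> x0"
    and objective_converges: "summable (\<lambda>t. u t (x t, x (Suc t)))"
  shows "x \<in> optimal \<Omega> u x0 \<longleftrightarrow>
    (\<forall>y \<in> feasible \<Omega> x0.
       summable (\<lambda>t. euler_term b u x y (Suc t)) \<and>
       D1 b (u 0) (x 0, x 1) * (x 0 - y 0) + (\<Sum>t. euler_term b u x y (Suc t))
         = (\<Sum>t. euler_term b u x y (Suc t)) \<and>
       (\<Sum>t. euler_term b u x y (Suc t)) \<ge> 0)"
proof -
  let ?S = "{0..b} \<times> {0..b}"
  let ?F = "feasible \<Omega> x0"
  define U where "U y = (\<lambda>t. u t (y t, y (Suc t)))" for y :: "nat \<Rightarrow> real"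
  let ?G = "gradient_term b u"
  obtain M where M: "summable M"
    "\<And>t p. p \<in> ?S \<Longrightarrow> \<bar>D1 b (u t) p\<bar> \<le> M t"
    "\<And>t p. p \<in> ?S \<Longrightarrow> \<bar>D2 b (u t) p\<bar> \<le> M t"
    using M3_uniform_bound[OF assms(1,3,4)] by blast
  note sq = feasible_square[OF assms(2)]
  have dist: "\<bar>y t - z t\<bar> \<le> b" if "y \<in> ?F" "z \<in> ?F" for y z t
    using sq[OF that(1), of t] sq[OF that(2), of t] by auto
  \<comment> \<open>The bound is independent of all three paths, so it serves both as comparison
    series and as dominating sequence in the limit \<open>a\<close> to 0.\<close>
  have G_bound: "\<bar>?G w (\<lambda>t. y t - z t) t\<bar> \<le> 2 * M t * b"
    if "w \<in> ?F" "y \<in> ?F" "z \<in> ?F" for w y z t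
    by (rule abs_gradient_term_le) (use M sq that dist in auto)
  have bound_summable: "summable (\<lambda>t. 2 * M t * b)"
    using M(1) by (intro summable_mult summable_mult2)
  have G_summable: "summable (?G w (\<lambda>t. y t - z t))" if "w \<in> ?F" "y \<in> ?F" "z \<in> ?F" for w y z
    using G_bound[OF that] by (intro summable_comparison_test'[OF bound_summable, of 0]) simp
  have U_le: "U y t - U w t \<le> ?G w (\<lambda>t. y t - w t) t" if "w \<in> ?F" "y \<in> ?F" for w y t
    unfolding U_def by (rule utility_diff_le_gradient_term[OF assms(1-3) that])
  \<comment> \<open>The tangent inequalities at \<open>x\<close> and at \<open>y\<close> bound
    \<open>U y t - U x t\<close> from both sides, which carries convergence over from
    \<open>x\<close> to \<open>y\<close>.\<close>
  have U_summable: "summable (U y)" if "y \<in> ?F" for y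
  proof -
    have "\<bar>U y t - U x t\<bar> \<le> 2 * M t * b" for t
      using U_le[OF that assms(6), of t] U_le[OF assms(6) that, of t]
        G_bound[OF that assms(6) that, of t] G_bound[OF assms(6) that assms(6), of t]
      by linarith
    then have "summable (\<lambda>t. U y t - U x t)"
      by (intro summable_comparison_test'[OF bound_summable, of 0]) simp
    moreover have "summable (U x)"
      using objective_converges by (simp add: U_def)
    ultimately have "summable (\<lambda>t. (U y t - U x t) + U x t)"
      by (rule summable_add)
    then show ?thesis by simp
  qed
  have E: "(\<lambda>t. euler_term b u x y (Suc t)) sums (\<Sum>t. ?G x (\<lambda>t. x t - y t) t)" if "y \<in> ?F" for y
    using euler_term_sums[OF assms(1-4,6) that] .
  \<comment> \<open>Sufficiency. The first-order sum in direction \<open>y - x\<close> is minus the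
    Euler sum.\<close>
  have "suminf (U y) \<le> suminf (U x)" if y: "y \<in> ?F" and nonneg: "(\<Sum>t. ?G x (\<lambda>t. x t - y t) t) \<ge> 0" for y
  proof -
    have "suminf (U y) - suminf (U x) = (\<Sum>t. U y t - U x t)"
      using U_summable y assms(6) by (simp add: suminf_diff)
    also have "\<dots> \<le> (\<Sum>t. ?G x (\<lambda>t. y t - x t) t)"
      using U_summable y assms(6) by (intro suminf_le U_le G_summable summable_diff)
    also have "\<dots> = - (\<Sum>t. ?G x (\<lambda>t. x t - y t) t)"
      using suminf_minus[OF G_summable[OF assms(6) assms(6) y]] gradient_term_mult[of b u x "-1" "\<lambda>t. x t - y t"]
      by simp
    finally show ?thesis using nonneg by simp
  qed
  moreover have "(\<Sum>t. ?G x (\<lambda>t. x t - y t) t) \<ge> 0"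
    if y: "y \<in> ?F" and opt: "\<And>z. z \<in> ?F \<Longrightarrow> suminf (U z) \<le> suminf (U x)" for y
  proof -
    \<comment> \<open>Necessity. The tangent at \<open>x\<close> bounds \<open>U (z a) - U x\<close>
      from above, which optimality does too; the tangent at \<open>z a\<close> instead bounds the
      nonnegative \<open>U x - U (z a)\<close> from above.\<close>
    define z where "z a t = x t + a * (y t - x t)" for a t
    have z: "z a \<in> ?F" if "0 \<le> a" "a \<le> 1" for a
      unfolding z_def using feasible_convex_combination[OF assms(2,6) y that] .
    define g where "g t a = ?G (z a) (\<lambda>t. x t - y t) t" for t a
    have small: "\<forall>\<^sub>F a in at_right 0. 0 < a \<and> a \<le> (1::real)"
      by (auto simp: eventually_at_right_field intro!: exI[of _ 1])
    have g_lim: "(g t \<longlongrightarrow> ?G x (\<lambda>t. x t - y t) t) (at_right 0)" for t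
    proof -
      have "((\<lambda>a. (z a t, z a (Suc t))) \<longlongrightarrow> (z 0 t, z 0 (Suc t))) (at_right 0)"
        unfolding z_def by (intro tendsto_intros)
      then have zlim: "((\<lambda>a. (z a t, z a (Suc t))) \<longlongrightarrow> (x t, x (Suc t))) (at_right 0)"
        by (simp add: z_def)
      \<comment> \<open>The partials are continuous only relative to the square, so the approaching
        points must lie in it.\<close>
      have ev: "\<forall>\<^sub>F a in at_right 0. (z a t, z a (Suc t)) \<in> ?S"
        using small by eventually_elim (rule sq[OF z]; simp)
      have cont: "continuous_on ?S (D1 b (u t))" "continuous_on ?S (D2 b (u t))"
        using assms(3) unfolding M2_def continuously_differentiable_def by blast+
      show ?thesis
        unfolding g_def gradient_term_def
        by (intro tendsto_add tendsto_mult_right sq[OF assms(6)]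
            continuous_on_tendsto_compose[OF cont(1) zlim _ ev]
            continuous_on_tendsto_compose[OF cont(2) zlim _ ev])
    qed
    have g_bound: "\<forall>\<^sub>F (t, a) in sequentially \<times>\<^sub>F at_right 0. norm (g t a) \<le> 2 * M t * b"
    proof -
      \<comment> \<open>The bound holds for every \<open>t\<close> as soon as \<open>a\<close> is in
        (0,1], so the condition on the product filter concerns \<open>a\<close> alone.\<close>
      have "\<forall>\<^sub>F p in sequentially \<times>\<^sub>F at_right 0. 0 < snd p \<and> snd p \<le> (1::real)"
        using eventually_prodI[OF eventually_True small] by simp
      then show ?thesis
        by eventually_elim
          (simp only: g_def case_prod_unfold real_norm_def, rule G_bound[OF z assms(6) y]; simp)
    qed
    have lim: "((\<lambda>a. \<Sum>t. g t a) \<longlongrightarrow> (\<Sum>t. ?G x (\<lambda>t. x t - y t) t)) (at_right 0)"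
      using tannerys_theorem[OF g_lim g_bound bound_summable] by simp
    have "0 \<le> (\<Sum>t. g t a)" if a: "0 < a" "a \<le> 1" for a
    proof -
      have za: "z a \<in> ?F" using z a by simp
      have "0 \<le> suminf (U x) - suminf (U (z a))" using opt[OF za] by simp
      also have "\<dots> = (\<Sum>t. U x t - U (z a) t)"
        using U_summable za assms(6) by (simp add: suminf_diff)
      also have "\<dots> \<le> (\<Sum>t. ?G (z a) (\<lambda>t. x t - z a t) t)"
        using U_summable za assms(6) by (intro suminf_le U_le G_summable summable_diff)
      \<comment> \<open>Linearity in the direction extracts the factor \<open>a\<close>, whose
        positivity then lets it be cancelled before the limit is taken.\<close>
      also have "(\<lambda>t. x t - z a t) = (\<lambda>t. a * (x t - y t))"
        by (simp add: z_def fun_eq_iff algebra_simps)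
      also have "(\<Sum>t. ?G (z a) (\<lambda>t. a * (x t - y t)) t) = a * (\<Sum>t. g t a)"
        unfolding gradient_term_mult g_def by (intro suminf_mult G_summable za y assms(6))
      finally show ?thesis using a by (simp add: zero_le_mult_iff)
    qed
    then have "\<forall>\<^sub>F a in at_right 0. 0 \<le> (\<Sum>t. g t a)"
      using small by (auto elim: eventually_mono)
    with lim show ?thesis
      by (rule tendsto_lowerbound) simp
  qed
  \<comment> \<open>\<open>U_summable\<close> settles the convergence clauses of
    \<open>optimal\<close>, leaving only the comparison of sums.\<close>
  moreover have "x \<in> optimal \<Omega> u x0 \<longleftrightarrow> (\<forall>y\<in>?F. suminf (U y) \<le> suminf (U x))"
    using assms(6) U_summable unfolding optimal_def U_def by auto
  moreover have "x 0 = y 0" if "y \<in> ?F" for y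
    using that assms(6) by (simp add: feasible_def)
  ultimately show ?thesis
    using sums_summable[OF E] sums_unique[OF E] by auto
qed

end
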